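(* Consider conditional density estimation with the logarithmic loss and a penalty $\phi:\mathcal F\to\mathbb R$. Let $Z_1^n=(Z_1,\dots,Z_n)$ be i.i.d. from $P$ and $(X,Y)\sim P$ independent of $Z_1^n$. Assume that the integral $\int_{\mathcal Y}\widehat f_{\phi,n}^{(X,y)}(y\mid X)\,e^{-\phi(\widehat f_{\phi,n}^{(X,y)})}\mu(dy)$ is finite (and positive) almost surely over $(Z_1^n,X)$. Then the Sample Minmax Predictor $$\widetilde f_{\phi,n}(x)=\operatorname*{arg\,min}_{p}\ \sup_{y\in\mathcal Y}\Big\{-\log p(y)+\log \widehat f_{\phi,n}^{(x,y)}(y\mid x)-\phi\big(\widehat f_{\phi,n}^{(x,y)}\big)\Big\}$$ (minimum over probability densities $p$ on $\mathcal Y$ with respect to $\mu$) is given by $$\widetilde f_{\phi,n}(y\mid x)=\frac{\widehat f_{\phi,n}^{(x,y)}(y\mid x)\,e^{-\phi(\widehat f_{\phi,n}^{(x,y)})}}{\int_{\mathcal Y}\widehat f_{\phi,n}^{(x,y')}(y'\mid x)\,e^{-\phi(\widehat f_{\phi,n}^{(x,y')})}\mu(dy')},$$ and it satisfies $$\mathbb E\big[\mathcal E_\phi(\widetilde f_{\phi,n})\big]\le\mathbb E_{Z_1^n,X}\Big[\log\Big(\int_{\mathcal Y}\widehat f_{\phi,n}^{(X,y)}(y\mid X)\,e^{-\phi(\widehat f_{\phi,n}^{(X,y)})}\mu(dy)\Big)\Big].$$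
   Context: $\mathcal X,\mathcal Y$ are measurable spaces, $\mu$ is a measure on $\mathcal Y$, $\mathcal F$ is a family of conditional densities $f(y\mid x)$ (for each $x\in\mathcal X$, $f(\cdot\mid x)$ is a probability density on $\mathcal Y$ with respect to $\mu$), and $P$ is a probability distribution on $\mathcal X\times\mathcal Y$. The logarithmic loss is $\ell(f,(x,y))=-\log f(y\mid x)$, and $\ell_\phi(f,z)=\ell(f,z)+\phi(f)$ for $f\in\mathcal F$. The risk is $\mathcal R(g)=\mathbb E_{(X,Y)\sim P}[-\log g(Y\mid X)]$ for a conditional density $g$, $\mathcal R_\phi(f)=\mathcal R(f)+\phi(f)$ for $f\in\mathcal F$, and $\mathcal E_\phi(g)=\mathcal R(g)-\inf_{f\in\mathcal F}\mathcal R_\phi(f)$. For $z\in\mathcal X\times\mathcal Y$, $\widehat f_{\phi,n}^{z}\in\operatorname{arg\,min}_{f\in\mathcal F}\{\sum_{i=1}^n\ell_\phi(f,Z_i)+\ell_\phi(f,z)\}$. Standing assumptions: risks are well defined in $\mathbb R\cup\{+\infty\}$ with $\inf_{\mathcal F}\mathcal R_\phi$ finite, all expectations appearing are well defined and the functions involved are measurable; for every $z\in\mathcal X\times\mathcal Y$ the minimum over $f\in\mathcal F$ of $\sum_{i=1}^n\ell_\phi(f,Z_i)+\ell_\phi(f,z)$ is attained, and the minimizers $\widehat f_{\phi,n}^{z}$ are chosen symmetrically in the $n+1$ sample points $Z_1,\dots,Z_n,z$. The formula for $\widetilde f_{\phi,n}(\cdot\mid x)$ is understood at those $(Z_1^n,x)$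 for which the integral $\int_{\mathcal Y}\widehat f_{\phi,n}^{(x,y')}(y'\mid x)\,e^{-\phi(\widehat f_{\phi,n}^{(x,y')})}\mu(dy')$ is finite and positive. *)

theory Defs
  imports "HOL-Probability.Probability"
begin

text \<open>
  Expectations of extended-real functions. The value is meaningful only if the positive or the
  negative part has finite integral; note that \<^const>\<open>e2ennreal\<close> truncates negative values to 0.
\<close>

definition quasi_integrable :: "'a measure \<Rightarrow> ('a \<Rightarrow> ereal) \<Rightarrow> bool" where
  "quasi_integrable M f \<longleftrightarrow> f \<in> borel_measurable M \<and>
     ((\<integral>\<^sup>+ w. e2ennreal (f w) \<partial>M) < \<infinity> \<or> (\<integral>\<^sup>+ w. e2ennreal (- f w) \<partial>M) < \<infinity>)"

definition ext_integral :: "'a measure \<Rightarrow> ('a \<Rightarrow> ereal) \<Rightarrow> ereal" where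
  "ext_integral M f =
     enn2ereal (\<integral>\<^sup>+ w. e2ennreal (f w) \<partial>M) - enn2ereal (\<integral>\<^sup>+ w. e2ennreal (- f w) \<partial>M)"

definition elog :: "ennreal \<Rightarrow> ereal" where
  "elog a = (if a = 0 then - \<infinity> else if a = \<infinity> then \<infinity> else ereal (ln (enn2real a)))"

definition prob_dens :: "'y measure \<Rightarrow> ('y \<Rightarrow> real) \<Rightarrow> bool" where
  "prob_dens \<mu> p \<longleftrightarrow> p \<in> borel_measurable \<mu> \<and> (\<forall>y\<in>space \<mu>. 0 \<le> p y) \<and>
     (\<integral>\<^sup>+ y. ennreal (p y) \<partial>\<mu>) = 1"

text \<open>A conditional density \<open>f(y | x)\<close> is represented by the curried function \<open>f x y\<close>.\<close>

type_synonym ('x, 'y) cdens = "'x \<Rightarrow> 'y \<Rightarrow> real"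

definition cond_dens :: "'x measure \<Rightarrow> 'y measure \<Rightarrow> ('x, 'y) cdens \<Rightarrow> bool" where
  "cond_dens MX \<mu> f \<longleftrightarrow> (\<lambda>(x, y). f x y) \<in> borel_measurable (MX \<Otimes>\<^sub>M \<mu>) \<and>
     (\<forall>x\<in>space MX. prob_dens \<mu> (f x))"

definition log_loss :: "('x, 'y) cdens \<Rightarrow> 'x \<times> 'y \<Rightarrow> ereal" where
  "log_loss f z = - elog (ennreal (f (fst z) (snd z)))"

definition pen_loss :: "(('x, 'y) cdens \<Rightarrow> real) \<Rightarrow> ('x, 'y) cdens \<Rightarrow> 'x \<times> 'y \<Rightarrow> ereal" where
  "pen_loss \<phi> f z = log_loss f z + ereal (\<phi> f)"

definition risk :: "('x \<times> 'y) measure \<Rightarrow> ('x, 'y) cdens \<Rightarrow> ereal" where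
  "risk P g = ext_integral P (log_loss g)"

definition pen_risk ::
  "('x \<times> 'y) measure \<Rightarrow> (('x, 'y) cdens \<Rightarrow> real) \<Rightarrow> ('x, 'y) cdens \<Rightarrow> ereal" where
  "pen_risk P \<phi> f = risk P f + ereal (\<phi> f)"

definition pen_excess_risk ::
  "('x \<times> 'y) measure \<Rightarrow> (('x, 'y) cdens \<Rightarrow> real) \<Rightarrow> ('x, 'y) cdens set \<Rightarrow> ('x, 'y) cdens \<Rightarrow> ereal"
where
  "pen_excess_risk P \<phi> F g = risk P g - (INF f\<in>F. pen_risk P \<phi> f)"

text \<open>
  A sample of size \<open>n\<close> is a point \<open>zs\<close> of a product space over the index set \<open>{..<n}\<close>.
  A rule \<open>fhat\<close> maps such a sample and one additional point \<open>z\<close> to an element of \<open>F\<close>.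
\<close>

definition is_pen_erm ::
  "('x, 'y) cdens set \<Rightarrow> (('x, 'y) cdens \<Rightarrow> real) \<Rightarrow> nat \<Rightarrow>
   (nat \<Rightarrow> 'x \<times> 'y) \<Rightarrow> 'x \<times> 'y \<Rightarrow> ('x, 'y) cdens \<Rightarrow> bool" where
  "is_pen_erm F \<phi> n zs z =
     is_arg_min (\<lambda>f. (\<Sum>i<n. pen_loss \<phi> f (zs i)) + pen_loss \<phi> f z) (\<lambda>f. f \<in> F)"

text \<open>
  Invariance of the rule under permutations of the \<open>n + 1\<close> points, the additional point being
  the one with index \<open>n\<close>.
\<close>

definition symmetric_rule ::
  "('x \<times> 'y) measure \<Rightarrow> nat \<Rightarrow> ((nat \<Rightarrow> 'x \<times> 'y) \<Rightarrow> 'x \<times> 'y \<Rightarrow> ('x, 'y) cdens) \<Rightarrow> bool" where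
  "symmetric_rule MZ n fhat \<longleftrightarrow>
     (\<forall>zs\<in>space (PiM {..n} (\<lambda>_. MZ)). \<forall>\<pi>. \<pi> permutes {..n} \<longrightarrow>
        fhat (restrict (zs \<circ> \<pi>) {..<n}) (zs (\<pi> n)) = fhat (restrict zs {..<n}) (zs n))"

text \<open>
  The term \<open>- log p(y) + log fhat(y | x) - \<phi>(fhat)\<close>, with \<open>fhat\<close> fitted on the sample augmented
  by \<open>(x, y)\<close>. It is read as \<open>- \<infinity>\<close> if \<open>fhat(y | x) = 0\<close>, also when \<open>p(y) = 0\<close>: such a \<open>y\<close> puts no
  constraint on \<open>p\<close>. (The library would evaluate the undefined \<open>\<infinity> - \<infinity>\<close> to \<open>\<infinity>\<close>.)
\<close>

definition smp_regret ::
  "(('x, 'y) cdens \<Rightarrow> real) \<Rightarrow> ((nat \<Rightarrow> 'x \<times> 'y) \<Rightarrow> 'x \<times> 'y \<Rightarrow> ('x, 'y) cdens) \<Rightarrow>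
   (nat \<Rightarrow> 'x \<times> 'y) \<Rightarrow> 'x \<Rightarrow> ('y \<Rightarrow> real) \<Rightarrow> 'y \<Rightarrow> ereal" where
  "smp_regret \<phi> fhat zs x p y =
     (if fhat zs (x, y) x y = 0 then - \<infinity>
      else - elog (ennreal (p y)) + elog (ennreal (fhat zs (x, y) x y))
             - ereal (\<phi> (fhat zs (x, y))))"

definition is_smp ::
  "'y measure \<Rightarrow> (('x, 'y) cdens \<Rightarrow> real) \<Rightarrow>
   ((nat \<Rightarrow> 'x \<times> 'y) \<Rightarrow> 'x \<times> 'y \<Rightarrow> ('x, 'y) cdens) \<Rightarrow>
   (nat \<Rightarrow> 'x \<times> 'y) \<Rightarrow> 'x \<Rightarrow> ('y \<Rightarrow> real) \<Rightarrow> bool" where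
  "is_smp \<mu> \<phi> fhat zs x =
     is_arg_min (\<lambda>p. SUP y\<in>space \<mu>. smp_regret \<phi> fhat zs x p y) (prob_dens \<mu>)"

definition smp_weight ::
  "(('x, 'y) cdens \<Rightarrow> real) \<Rightarrow> ((nat \<Rightarrow> 'x \<times> 'y) \<Rightarrow> 'x \<times> 'y \<Rightarrow> ('x, 'y) cdens) \<Rightarrow>
   (nat \<Rightarrow> 'x \<times> 'y) \<Rightarrow> 'x \<Rightarrow> 'y \<Rightarrow> real" where
  "smp_weight \<phi> fhat zs x y = fhat zs (x, y) x y * exp (- \<phi> (fhat zs (x, y)))"

definition smp_norm ::
  "'y measure \<Rightarrow> (('x, 'y) cdens \<Rightarrow> real) \<Rightarrow>
   ((nat \<Rightarrow> 'x \<times> 'y) \<Rightarrow> 'x \<times> 'y \<Rightarrow> ('x, 'y) cdens) \<Rightarrow>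
   (nat \<Rightarrow> 'x \<times> 'y) \<Rightarrow> 'x \<Rightarrow> ennreal" where
  "smp_norm \<mu> \<phi> fhat zs x = (\<integral>\<^sup>+ y. ennreal (smp_weight \<phi> fhat zs x y) \<partial>\<mu>)"

text \<open>Where the normalizer is 0 or infinite, the following has the junk value 0.\<close>

definition smp ::
  "'y measure \<Rightarrow> (('x, 'y) cdens \<Rightarrow> real) \<Rightarrow>
   ((nat \<Rightarrow> 'x \<times> 'y) \<Rightarrow> 'x \<times> 'y \<Rightarrow> ('x, 'y) cdens) \<Rightarrow>
   (nat \<Rightarrow> 'x \<times> 'y) \<Rightarrow> ('x, 'y) cdens" where
  "smp \<mu> \<phi> fhat zs x y = smp_weight \<phi> fhat zs x y / enn2real (smp_norm \<mu> \<phi> fhat zs x)"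

end

(*
  Pointwise in y, the regret of p is at most s iff the weight w(y) = fhat(y|x) exp (- phi(fhat)) is
  at most e^s p(y). Integrating, a regret bound s forces e^s to be at least the normalizer c, and
  s = log c forces p >= w/c, hence p = w/c almost everywhere since both have mass one.

  For the risk bound, the loss of the predictor at the test point splits as A + log c, where A is the
  penalized loss of the augmented minimizer at that point. By symmetry the n + 1 penalized losses of
  the augmented minimizer are identically distributed, and their sum is at most the sum for any fixed
  f in F, so E A is at most the penalized risk of f. A itself is not assumed to have a
  well-defined expectation. If E (log c)^+ is infinite, or if the negative part of the loss has
  infinite expectation, the inequality is trivial; otherwise the negative part of A is integrable,
  and then the upper bound on the sum makes A integrable.
*)
theory Submission
  imports Defs
begin

section \<open>The minmax problem for a fixed sample and covariate\<close>

lemma regret_le_iff: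
  fixes w p s :: real
  assumes "0 \<le> w" "0 \<le> p"
  shows "(if w = 0 then - \<infinity> else ereal (ln w) - elog (ennreal p)) \<le> ereal s \<longleftrightarrow> w \<le> exp s * p"
proof (cases "w = 0 \<or> p = 0")
  \<comment> \<open>The conventions match the multiplicative form: \<open>w = 0\<close> gives
    -\<infinity> against \<open>0 \<le> exp s * p\<close>, both true, while \<open>p = 0 < w\<close>
    gives \<infinity> against \<open>w \<le> 0\<close>, both false.\<close>
  case True
  with assms show ?thesis by (auto simp: elog_def)
next
  case False
  with assms have "w > 0" "p > 0" by auto
  then have "w \<le> exp s * p \<longleftrightarrow> ln w \<le> s + ln p"
    by (subst ln_le_cancel_iff [symmetric]) (auto simp: ln_mult)
  with \<open>w > 0\<close> \<open>p > 0\<close> show ?thesis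
    by (auto simp: elog_def)
qed

text \<open>Since \<open>exp\<close> is positive, the weight vanishes exactly where
  \<open>fhat\<close> does, so the convention for that case carries over; elsewhere the penalty is
  absorbed into the logarithm.\<close>

lemma smp_regret_eq:
  assumes "0 \<le> fhat zs (x, y) x y"
  shows "smp_regret \<phi> fhat zs x p y =
    (if smp_weight \<phi> fhat zs x y = 0 then - \<infinity>
     else ereal (ln (smp_weight \<phi> fhat zs x y)) - elog (ennreal (p y)))"
  using assms
  by (cases "elog (ennreal (p y))") (auto simp: smp_regret_def smp_weight_def elog_def ln_mult)

text \<open>Trades a supremum of extended reals for inequalities between real functions, which can
  be integrated over \<open>y\<close>.\<close>

lemma SUP_smp_regret_le_iff:
  assumes "\<And>y. y \<in> space \<mu> \<Longrightarrow> 0 \<le> fhat zs (x, y) x y" "\<And>y. y \<in> space \<mu> \<Longrightarrow> 0 \<le> p y"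
  shows "(SUP y\<in>space \<mu>. smp_regret \<phi> fhat zs x p y) \<le> ereal s \<longleftrightarrow>
    (\<forall>y\<in>space \<mu>. smp_weight \<phi> fhat zs x y \<le> exp s * p y)"
  unfolding SUP_le_iff
  by (intro ball_cong refl, subst smp_regret_eq, use assms in simp, subst regret_le_iff)
     (use assms in \<open>auto simp: smp_weight_def\<close>)

text \<open>The difference is nonnegative and has integral \<open>1 - 1 = 0\<close>. This is the
  source of uniqueness of the minimizer.\<close>

lemma prob_dens_le_imp_AE_eq:
  assumes p: "prob_dens \<mu> p" and q: "prob_dens \<mu> q" and le: "\<And>y. y \<in> space \<mu> \<Longrightarrow> q y \<le> p y"
  shows "AE y in \<mu>. p y = q y"
proof -
  have int: "integrable \<mu> h \<and> integral\<^sup>L \<mu> h = 1" if "prob_dens \<mu> h" for h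
  proof -
    from that have h: "h \<in> borel_measurable \<mu>" "AE y in \<mu>. 0 \<le> h y"
        "(\<integral>\<^sup>+ y. ennreal (h y) \<partial>\<mu>) = ennreal 1"
      by (auto simp: prob_dens_def)
    show ?thesis
      using nn_integral_eq_integrable[of h \<mu> 1] h by auto
  qed
  have "integral\<^sup>L \<mu> (\<lambda>y. p y - q y) = 0"
    using int[OF p] int[OF q] by simp
  moreover have "integrable \<mu> (\<lambda>y. p y - q y)" using int[OF p] int[OF q] by simp
  ultimately have "AE y in \<mu>. p y - q y = 0"
    using le by (subst (asm) integral_nonneg_eq_0_iff_AE) auto
  then show ?thesis by auto
qed

lemma smp_is_smp_unique:
  assumes nn: "\<And>y. y \<in> space \<mu> \<Longrightarrow> 0 \<le> fhat zs (x, y) x y"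
    and meas: "smp_weight \<phi> fhat zs x \<in> borel_measurable \<mu>"
    and pos: "0 < smp_norm \<mu> \<phi> fhat zs x" and fin: "smp_norm \<mu> \<phi> fhat zs x < \<infinity>"
  shows "is_smp \<mu> \<phi> fhat zs x (smp \<mu> \<phi> fhat zs x)"
    and "is_smp \<mu> \<phi> fhat zs x p \<Longrightarrow> AE y in \<mu>. p y = smp \<mu> \<phi> fhat zs x y"
proof -
  define w where "w = smp_weight \<phi> fhat zs x"
  define c where "c = enn2real (smp_norm \<mu> \<phi> fhat zs x)"
  let ?q = "smp \<mu> \<phi> fhat zs x"
  let ?V = "\<lambda>p. SUP y\<in>space \<mu>. smp_regret \<phi> fhat zs x p y"
  have w: "w \<in> borel_measurable \<mu>" "\<And>y. y \<in> space \<mu> \<Longrightarrow> 0 \<le> w y"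
    using meas nn by (auto simp: w_def smp_weight_def)
  have c: "0 < c" "(\<integral>\<^sup>+ y. ennreal (w y) \<partial>\<mu>) = ennreal c"
    using pos fin by (auto simp: c_def w_def smp_norm_def enn2real_positive_iff)
  have q: "?q y = w y / c" for y
    by (simp add: smp_def w_def c_def)
  have q_dens: "prob_dens \<mu> ?q"
  proof -
    have "(\<integral>\<^sup>+ y. ennreal (w y / c) \<partial>\<mu>) = (\<integral>\<^sup>+ y. ennreal (w y) * ennreal (1 / c) \<partial>\<mu>)"
      using c w by (intro nn_integral_cong) (simp add: ennreal_mult[symmetric])
    also have "\<dots> = 1"
      using c w by (simp add: nn_integral_multc ennreal_mult[symmetric])
    finally show ?thesis
      using c w by (simp add: prob_dens_def q[abs_def])
  qed
  have V_le: "?V p \<le> ereal s \<longleftrightarrow> (\<forall>y\<in>space \<mu>. w y \<le> exp s * p y)" if "prob_dens \<mu> p" for p s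
    using SUP_smp_regret_le_iff[of \<mu> fhat zs x p] nn that by (simp add: w_def prob_dens_def)
  \<comment> \<open>At \<open>exp s = c\<close> the constraint
    \<open>w y \<le> c * (w y / c)\<close> is an equality: the predictor equalizes the regret
    wherever the weight is positive.\<close>
  have V_q: "?V ?q \<le> ereal (ln c)"
    using c by (subst V_le[OF q_dens]) (simp add: q)
  have V_ge: "ereal (ln c) \<le> ?V p" if p: "prob_dens \<mu> p" for p
  proof (rule ccontr)
    assume "\<not> ?thesis"
    \<comment> \<open>\<open>V_le\<close> needs a real level, whereas the supremum may be
      -\<infinity>; hence a real \<open>s\<close> below \<open>ln c\<close> is interpolated.
      Integrating the pointwise bounds then compares masses.\<close>
    then obtain s where s: "?V p < ereal s" "ereal s < ereal (ln c)"
      using ereal_dense2[of "?V p" "ereal (ln c)"] by (auto simp: not_le)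
    have "ennreal c \<le> (\<integral>\<^sup>+ y. ennreal (exp s) * ennreal (p y) \<partial>\<mu>)"
      unfolding c(2)[symmetric]
    proof (intro nn_integral_mono)
      fix y assume "y \<in> space \<mu>"
      then show "ennreal (w y) \<le> ennreal (exp s) * ennreal (p y)"
        using V_le[OF p, of s] s(1) p
        by (auto simp: ennreal_mult[symmetric] prob_dens_def intro!: ennreal_leI)
    qed
    also have "\<dots> = ennreal (exp s)"
      using p by (subst nn_integral_cmult) (auto simp: prob_dens_def)
    finally have "c \<le> exp s" by simp
    moreover have "exp s < c"
      using s(2) c(1) by (metis exp_less_cancel_iff exp_ln ereal_less(3) less_ereal.simps(1))
    ultimately show False by simp
  qed
  show "is_smp \<mu> \<phi> fhat zs x ?q"
    unfolding is_smp_def is_arg_min_def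
    using q_dens V_q V_ge by (meson dual_order.trans not_le)
  assume "is_smp \<mu> \<phi> fhat zs x p"
  then have p: "prob_dens \<mu> p" and "\<not> ?V ?q < ?V p"
    using q_dens by (auto simp: is_smp_def is_arg_min_def)
  \<comment> \<open>A minimizer does as well as \<open>?q\<close>, so the level \<open>ln c\<close>
    is admissible for it, and \<open>w \<le> c * p\<close> says that \<open>p\<close> dominates
    \<open>?q\<close>.\<close>
  then have "?V p \<le> ereal (ln c)" using V_q by (meson dual_order.trans not_le)
  then have "?q y \<le> p y" if "y \<in> space \<mu>" for y
    using V_le[OF p, of "ln c"] c(1) that by (simp add: q field_simps)
  then show "AE y in \<mu>. p y = ?q y"
    by (rule prob_dens_le_imp_AE_eq[OF p q_dens])
qed

section \<open>Expectations of extended-real functions\<close>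

lemma ext_integral_eq_integral:
  assumes f: "integrable M f" and eq: "AE w in M. F w = ereal (f w)"
  shows "ext_integral M F = ereal (integral\<^sup>L M f)"
proof -
  have "(\<integral>\<^sup>+ w. e2ennreal (F w) \<partial>M) = (\<integral>\<^sup>+ w. ennreal (f w) \<partial>M)"
    using eq by (intro nn_integral_cong_AE) auto
  moreover have "(\<integral>\<^sup>+ w. e2ennreal (- F w) \<partial>M) = (\<integral>\<^sup>+ w. ennreal (- f w) \<partial>M)"
    using eq by (intro nn_integral_cong_AE) auto
  moreover have "(\<integral>\<^sup>+ w. ennreal (f w) \<partial>M) < \<infinity>" "(\<integral>\<^sup>+ w. ennreal (- f w) \<partial>M) < \<infinity>"
    using f by (auto simp: real_integrable_def less_top)
  then obtain a b where "0 \<le> a" "(\<integral>\<^sup>+ w. ennreal (f w) \<partial>M) = ennreal a"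
      "0 \<le> b" "(\<integral>\<^sup>+ w. ennreal (- f w) \<partial>M) = ennreal b"
    by (metis ennreal_cases infinity_ennreal_def less_irrefl)
  ultimately show ?thesis
    by (simp add: ext_integral_def real_lebesgue_integral_def[OF f])
qed

lemma integrable_real_of_ereal:
  assumes F: "F \<in> borel_measurable M"
    and pos: "(\<integral>\<^sup>+ w. e2ennreal (F w) \<partial>M) < \<infinity>"
    and neg: "(\<integral>\<^sup>+ w. e2ennreal (- F w) \<partial>M) < \<infinity>"
  shows "integrable M (\<lambda>w. real_of_ereal (F w))" and "AE w in M. F w = ereal (real_of_ereal (F w))"
proof -
  have "AE w in M. e2ennreal (F w) \<noteq> \<infinity>"
    using F pos by (intro nn_integral_PInf_AE) auto
  moreover have "AE w in M. e2ennreal (- F w) \<noteq> \<infinity>"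
    using F neg by (intro nn_integral_PInf_AE) auto
  ultimately show "AE w in M. F w = ereal (real_of_ereal (F w))"
  proof eventually_elim
    case (elim w)
    then show ?case by (cases "F w") auto
  qed
  \<comment> \<open>The bound holds even at infinite values, where \<open>real_of_ereal\<close>
    returns 0.\<close>
  have "(\<integral>\<^sup>+ w. ennreal (norm (real_of_ereal (F w))) \<partial>M)
      \<le> (\<integral>\<^sup>+ w. e2ennreal (F w) + e2ennreal (- F w) \<partial>M)"
  proof (intro nn_integral_mono)
    fix w
    show "ennreal (norm (real_of_ereal (F w))) \<le> e2ennreal (F w) + e2ennreal (- F w)"
      by (cases "F w"; cases "real_of_ereal (F w) \<ge> 0") (auto simp: ennreal_neg)
  qed
  also have "\<dots> < \<infinity>"
    using F pos neg by (subst nn_integral_add) auto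
  finally show "integrable M (\<lambda>w. real_of_ereal (F w))"
    using F by (simp add: integrable_iff_bounded)
qed

lemma ext_integral_eq_minus_infty:
  assumes "(\<integral>\<^sup>+ w. e2ennreal (F w) \<partial>M) < \<infinity>" "(\<integral>\<^sup>+ w. e2ennreal (- F w) \<partial>M) = \<infinity>"
  shows "ext_integral M F = - \<infinity>"
  using assms by (cases "(\<integral>\<^sup>+ w. e2ennreal (F w) \<partial>M)") (auto simp: ext_integral_def)

lemma measurable_elog [measurable]: "elog \<in> borel_measurable borel"
  unfolding elog_def by measurable

lemma ext_integral_distr:
  assumes "T \<in> measurable M N" "F \<in> borel_measurable N"
  shows "ext_integral (distr M N T) F = ext_integral M (\<lambda>w. F (T w))"
  using assms by (simp add: ext_integral_def nn_integral_distr)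

section \<open>Exchangeable sums, and splitting off one coordinate of a product\<close>

lemma integrable_exchangeable_sum:
  fixes A :: "'a \<Rightarrow> ereal" and G :: "'i \<Rightarrow> 'a \<Rightarrow> real"
  assumes I: "finite I" "k \<in> I"
    and T: "\<And>i. i \<in> I \<Longrightarrow> T i \<in> measurable M M" "\<And>i. i \<in> I \<Longrightarrow> distr M M (T i) = M"
    and T_k: "\<And>x. x \<in> space M \<Longrightarrow> T k x = x"
    and A [measurable]: "A \<in> borel_measurable M"
    and A_neg: "(\<integral>\<^sup>+ x. e2ennreal (- A x) \<partial>M) < \<infinity>"
    and A_MInf: "\<And>x. x \<in> space M \<Longrightarrow> A x \<noteq> - \<infinity>"
    and G: "\<And>i. i \<in> I \<Longrightarrow> integrable M (G i)" "\<And>i. i \<in> I \<Longrightarrow> integral\<^sup>L M (G i) = r"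
    and le: "AE x in M. (\<Sum>i\<in>I. A (T i x)) \<le> ereal (\<Sum>i\<in>I. G i x)"
  shows "integrable M (\<lambda>x. real_of_ereal (A x))" "AE x in M. A x = ereal (real_of_ereal (A x))"
    "(\<integral>x. real_of_ereal (A x) \<partial>M) \<le> r"
proof -
  \<comment> \<open>Every \<open>A \<circ> T i\<close> has the law of \<open>A\<close>, so the sum
    has \<open>card I\<close> times the expectation of \<open>A\<close>. Integrability comes first:
    an upper bound on the sum and integrable negative parts of all summands control each positive
    part.\<close>
  define b where "b i x = real_of_ereal (A (T i x))" for i x
  have [measurable]: "T i \<in> measurable M M" if "i \<in> I" for i using T that by auto
  have A_eq: "AE x in M. \<forall>i\<in>I. A (T i x) = ereal (b i x)"
    using le AE_space
  proof eventually_elim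
    case (elim x)
    \<comment> \<open>A sum below a real number has no summand \<infinity>, and
      \<open>A_MInf\<close> excludes -\<infinity>, so all summands are real.\<close>
    then have "(\<Sum>i\<in>I. A (T i x)) \<noteq> \<infinity>" by auto
    then have "A (T i x) \<noteq> \<infinity>" if "i \<in> I" for i
      using that I by (auto simp: sum_Pinfty)
    moreover have "A (T i x) \<noteq> - \<infinity>" if "i \<in> I" for i
      using A_MInf measurable_space[OF T(1)[OF that]] elim by auto
    ultimately show ?case
      by (auto simp: b_def intro!: ereal_real'[symmetric])
  qed
  have b_meas [measurable]: "b i \<in> borel_measurable M" if "i \<in> I" for i
    using that unfolding b_def by measurable
  have neg: "integrable M (\<lambda>x. max 0 (- b i x))" if i: "i \<in> I" for i
  proof -
    have "(\<integral>\<^sup>+ x. ennreal (max 0 (- b i x)) \<partial>M) = (\<integral>\<^sup>+ x. e2ennreal (- A (T i x)) \<partial>M)"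
      using A_eq by (intro nn_integral_cong_AE, eventually_elim) (use i in \<open>auto simp: max_def ennreal_neg\<close>)
    also have "\<dots> = (\<integral>\<^sup>+ x. e2ennreal (- A x) \<partial>distr M M (T i))"
      using i by (subst nn_integral_distr) auto
    also have "\<dots> < \<infinity>" using T(2)[OF i] A_neg by simp
    finally show ?thesis
      using i by (intro integrableI_nonneg) auto
  qed
  have le': "AE x in M. (\<Sum>i\<in>I. b i x) \<le> (\<Sum>i\<in>I. G i x)"
    using le A_eq by eventually_elim simp
  have b_int: "integrable M (b i)" if i: "i \<in> I" for i
  proof (rule Bochner_Integration.integrable_bound)
    show "integrable M (\<lambda>x. \<bar>\<Sum>j\<in>I. G j x\<bar> + (\<Sum>j\<in>I. max 0 (- b j x)))"
      using G neg by auto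
    show "AE x in M. norm (b i x) \<le> norm (\<bar>\<Sum>j\<in>I. G j x\<bar> + (\<Sum>j\<in>I. max 0 (- b j x)))"
      using le'
    proof eventually_elim
      case (elim x)
      \<comment> \<open>One positive part is at most the sum of all of them, and
        \<open>max 0 t = t + max 0 (- t)\<close> rewrites that as the bounded sum plus the negative
        parts.\<close>
      have "max 0 (b i x) \<le> (\<Sum>j\<in>I. max 0 (b j x))"
        using i I by (intro member_le_sum) auto
      also have "\<dots> = (\<Sum>j\<in>I. b j x + max 0 (- b j x))"
        by (intro sum.cong) auto
      also have "\<dots> = (\<Sum>j\<in>I. b j x) + (\<Sum>j\<in>I. max 0 (- b j x))"
        by (rule sum.distrib)
      finally have "max 0 (b i x) \<le> \<bar>\<Sum>j\<in>I. G j x\<bar> + (\<Sum>j\<in>I. max 0 (- b j x))"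
        using elim by linarith
      moreover have "max 0 (- b i x) \<le> (\<Sum>j\<in>I. max 0 (- b j x))"
        using i I by (intro member_le_sum) auto
      ultimately show ?case by simp linarith
    qed
  qed (use i in measurable)
  have b_k: "b k x = real_of_ereal (A x)" if "x \<in> space M" for x
    using T_k[OF that] by (simp add: b_def)
  show int: "integrable M (\<lambda>x. real_of_ereal (A x))"
    using b_int[OF I(2)] by (rule Bochner_Integration.integrable_cong[THEN iffD1, rotated -1]) (auto simp: b_k)
  show "AE x in M. A x = ereal (real_of_ereal (A x))"
    using A_eq AE_space by eventually_elim (use I b_k T_k in auto)
  let ?a = "\<integral>x. real_of_ereal (A x) \<partial>M"
  have b_eq: "integral\<^sup>L M (b i) = ?a" if i: "i \<in> I" for i
  proof -
    have "?a = (\<integral>x. real_of_ereal (A x) \<partial>distr M M (T i))"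
      using T(2)[OF i] by simp
    then show ?thesis
      using i by (simp add: integral_distr b_def[abs_def])
  qed
  have "(\<integral>x. (\<Sum>i\<in>I. b i x) \<partial>M) \<le> (\<integral>x. (\<Sum>i\<in>I. G i x) \<partial>M)"
    using le' b_int G by (intro integral_mono_AE) auto
  then have "card I * ?a \<le> card I * r"
    using b_int G by (simp add: b_eq)
  moreover have "card I > 0" using I by (auto simp: card_gt_0_iff)
  ultimately show "?a \<le> r" by simp
qed

text \<open>The product law is the image of a pair under insertion of coordinate \<open>i\<close>.
  Splitting undoes the insertion, because \<open>i \<notin> I\<close> and tuples are extensional, up
  to swapping the two factors.\<close>

lemma distr_PiM_insert_split:
  assumes M: "\<And>j. prob_space (M j)" and i: "i \<notin> I"
  shows "distr (PiM (insert i I) M) (PiM I M \<Otimes>\<^sub>M M i) (\<lambda>\<omega>. (restrict \<omega> I, \<omega> i)) = PiM I M \<Otimes>\<^sub>M M i"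
proof -
  interpret I: prob_space "PiM I M" by (intro prob_space_PiM M)
  interpret i: prob_space "M i" by (rule M)
  interpret pair_sigma_finite "PiM I M" "M i" ..
  have "distr (PiM (insert i I) M) (PiM I M \<Otimes>\<^sub>M M i) (\<lambda>\<omega>. (restrict \<omega> I, \<omega> i)) =
      distr (distr (M i \<Otimes>\<^sub>M PiM I M) (PiM (insert i I) M) (\<lambda>(x, X). X(i := x)))
        (PiM I M \<Otimes>\<^sub>M M i) (\<lambda>\<omega>. (restrict \<omega> I, \<omega> i))"
    by (simp add: distr_pair_PiM_eq_PiM M)
  also have "\<dots> = distr (M i \<Otimes>\<^sub>M PiM I M) (PiM I M \<Otimes>\<^sub>M M i)
      ((\<lambda>\<omega>. (restrict \<omega> I, \<omega> i)) \<circ> (\<lambda>(x, X). X(i := x)))"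
  proof (rule distr_distr)
    show "(\<lambda>\<omega>. (restrict \<omega> I, \<omega> i)) \<in> measurable (PiM (insert i I) M) (PiM I M \<Otimes>\<^sub>M M i)"
      by (intro measurable_Pair measurable_restrict_subset measurable_component_singleton) auto
    show "(\<lambda>(x, X). X(i := x)) \<in> measurable (M i \<Otimes>\<^sub>M PiM I M) (PiM (insert i I) M)"
      by measurable
  qed
  also have "\<dots> = distr (M i \<Otimes>\<^sub>M PiM I M) (PiM I M \<Otimes>\<^sub>M M i) (\<lambda>(x, y). (y, x))"
  proof (rule distr_cong, rule refl, rule refl)
    fix p assume "p \<in> space (M i \<Otimes>\<^sub>M PiM I M)"
    then have "restrict ((snd p)(i := fst p)) I = snd p"
      using i by (auto simp: space_pair_measure space_PiM PiE_def extensional_def fun_eq_iff)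
    then show "((\<lambda>\<omega>. (restrict \<omega> I, \<omega> i)) \<circ> (\<lambda>(x, X). X(i := x))) p = (case p of (x, y) \<Rightarrow> (y, x))"
      by (simp add: case_prod_beta)
  qed
  also have "\<dots> = PiM I M \<Otimes>\<^sub>M M i"
    by (rule distr_pair_swap[symmetric])
  finally show ?thesis .
qed

section \<open>Fubini for extended-real risks\<close>

lemma ext_integral_fibre_real:
  assumes S: "prob_space S" and P: "prob_space P"
    and h: "h \<in> borel_measurable (S \<Otimes>\<^sub>M P)"
    and pos: "(\<integral>\<^sup>+ w. e2ennreal (h w) \<partial>(S \<Otimes>\<^sub>M P)) < \<infinity>"
    and neg: "(\<integral>\<^sup>+ w. e2ennreal (- h w) \<partial>(S \<Otimes>\<^sub>M P)) < \<infinity>"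
  shows "ext_integral S (\<lambda>x. ext_integral P (\<lambda>z. h (x, z)) - ereal c) =
    ereal ((\<integral>w. real_of_ereal (h w) \<partial>(S \<Otimes>\<^sub>M P)) - c)"
proof -
  interpret S: prob_space S by fact
  interpret P: prob_space P by fact
  interpret pair_sigma_finite S P ..
  let ?h = "\<lambda>w. real_of_ereal (h w)"
  note hr = integrable_real_of_ereal[OF h pos neg]
  \<comment> \<open>Almost every fibre is integrable and real-valued off a null set, so the inner
    expectation is a Lebesgue integral there and ordinary Fubini applies.\<close>
  have "AE x in S. ext_integral P (\<lambda>z. h (x, z)) = ereal (\<integral>z. ?h (x, z) \<partial>P)"
    using AE_pair[OF hr(2)] AE_integrable_fst'[OF hr(1)]
    by eventually_elim (rule ext_integral_eq_integral)
  then have "AE x in S. ext_integral P (\<lambda>z. h (x, z)) - ereal c = ereal ((\<integral>z. ?h (x, z) \<partial>P) - c)"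
    by eventually_elim simp
  then have "ext_integral S (\<lambda>x. ext_integral P (\<lambda>z. h (x, z)) - ereal c) =
      ereal (\<integral>x. (\<integral>z. ?h (x, z) \<partial>P) - c \<partial>S)"
    using integrable_fst'[OF hr(1)] by (intro ext_integral_eq_integral) auto
  also have "(\<integral>x. (\<integral>z. ?h (x, z) \<partial>P) - c \<partial>S) = integral\<^sup>L (S \<Otimes>\<^sub>M P) ?h - c"
    using integrable_fst'[OF hr(1)] by (simp add: integral_fst'[OF hr(1)] S.prob_space)
  finally show ?thesis .
qed

lemma borel_measurable_ext_integral_fibre:
  assumes "sigma_finite_measure P" and h [measurable]: "h \<in> borel_measurable (S \<Otimes>\<^sub>M P)"
  shows "(\<lambda>x. ext_integral P (\<lambda>z. h (x, z))) \<in> borel_measurable S"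
proof -
  interpret sigma_finite_measure P by fact
  show ?thesis unfolding ext_integral_def by measurable
qed

text \<open>The fibre expectations may be -\<infinity> themselves, or be finite with a divergent
  outer integral. Bounding \<open>v\<close> by the negative part of \<open>R\<close> plus an
  integrable term handles both.\<close>

lemma ext_integral_fibre_minus_infty:
  assumes S: "prob_space S" and P: "prob_space P"
    and h [measurable]: "h \<in> borel_measurable (S \<Otimes>\<^sub>M P)"
    and pos: "(\<integral>\<^sup>+ w. e2ennreal (h w) \<partial>(S \<Otimes>\<^sub>M P)) < \<infinity>"
    and neg: "(\<integral>\<^sup>+ w. e2ennreal (- h w) \<partial>(S \<Otimes>\<^sub>M P)) = \<infinity>"
  shows "ext_integral S (\<lambda>x. ext_integral P (\<lambda>z. h (x, z)) - ereal c) = - \<infinity>"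
proof -
  interpret S: prob_space S by fact
  interpret P: prob_space P by fact
  define u where "u x = (\<integral>\<^sup>+ z. e2ennreal (h (x, z)) \<partial>P)" for x
  define v where "v x = (\<integral>\<^sup>+ z. e2ennreal (- h (x, z)) \<partial>P)" for x
  define R where "R x = ext_integral P (\<lambda>z. h (x, z)) - ereal c" for x
  have [measurable]: "u \<in> borel_measurable S" "v \<in> borel_measurable S"
    unfolding u_def v_def by measurable
  have [measurable]: "R \<in> borel_measurable S"
    unfolding R_def by (intro borel_measurable_ereal_diff borel_measurable_ext_integral_fibre h)
      (auto intro: P.sigma_finite_measure_axioms)
  have u: "(\<integral>\<^sup>+ x. u x \<partial>S) < \<infinity>" and v: "(\<integral>\<^sup>+ x. v x \<partial>S) = \<infinity>"
    using pos neg unfolding u_def v_def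
    by (subst P.nn_integral_fst[where f="\<lambda>w. e2ennreal (h w)"] P.nn_integral_fst[where f="\<lambda>w. e2ennreal (- h w)"]; simp)+
  have "AE x in S. u x \<noteq> \<infinity>"
    using u by (intro nn_integral_PInf_AE) (auto simp: less_top)
  \<comment> \<open>Where \<open>u x\<close> is finite, \<open>R x = u x - v x - c\<close> involves
    no undefined difference, so \<open>R x\<close> differs from \<open>- v x\<close> by at most
    \<open>u x + \<bar>c\<bar>\<close> when \<open>v x\<close> is finite, and is -\<infinity>
    otherwise.\<close>
  then have R: "AE x in S. e2ennreal (R x) \<le> u x + ennreal \<bar>c\<bar> \<and>
      v x \<le> e2ennreal (- R x) + (u x + ennreal \<bar>c\<bar>)"
  proof eventually_elim
    case (elim x)
    then obtain a where a: "u x = ennreal a" "0 \<le> a"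
      by (cases "u x") auto
    have R_eq: "R x = enn2ereal (u x) - enn2ereal (v x) - ereal c"
      by (simp add: R_def ext_integral_def u_def v_def)
    show ?case
      by (cases "v x") (auto simp: R_eq a ennreal_plus[symmetric] intro!: ennreal_leI simp del: ennreal_plus,
        auto simp: ennreal_plus_if e2ennreal_neg intro!: ennreal_leI)
  qed
  have fin: "(\<integral>\<^sup>+ x. u x + ennreal \<bar>c\<bar> \<partial>S) < \<infinity>"
    using u by (subst nn_integral_add) (auto simp: S.emeasure_space_1)
  have "(\<integral>\<^sup>+ x. e2ennreal (R x) \<partial>S) \<le> (\<integral>\<^sup>+ x. u x + ennreal \<bar>c\<bar> \<partial>S)"
    using R by (intro nn_integral_mono_AE) auto
  with fin have "(\<integral>\<^sup>+ x. e2ennreal (R x) \<partial>S) < \<infinity>"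
    using le_less_trans by blast
  moreover have "(\<integral>\<^sup>+ x. v x \<partial>S) \<le> (\<integral>\<^sup>+ x. e2ennreal (- R x) + (u x + ennreal \<bar>c\<bar>) \<partial>S)"
    using R by (intro nn_integral_mono_AE) auto
  then have "\<infinity> \<le> (\<integral>\<^sup>+ x. e2ennreal (- R x) \<partial>S) + (\<integral>\<^sup>+ x. u x + ennreal \<bar>c\<bar> \<partial>S)"
    unfolding v by (subst (asm) nn_integral_add) auto
  then have "(\<integral>\<^sup>+ x. e2ennreal (- R x) \<partial>S) = \<infinity>"
    using fin by (auto simp: top_unique)
  ultimately show ?thesis
    unfolding R_def[symmetric] by (rule ext_integral_eq_minus_infty)
qed

section \<open>Penalized loss of the augmented minimizer\<close>

lemma sets_symmetric_rule_cong:
  "sets M = sets N \<Longrightarrow> symmetric_rule M n fhat = symmetric_rule N n fhat"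
  unfolding symmetric_rule_def by (metis (no_types, lifting) sets_PiM_cong sets_eq_imp_space_eq)

text \<open>A density value is a real number, so its \<open>elog\<close> is never \<infinity>. Sums
  of penalized losses thus never meet \<open>\<infinity> - \<infinity>\<close>.\<close>

lemma pen_loss_not_MInf: "pen_loss \<phi> f z \<noteq> - \<infinity>"
  by (auto simp: pen_loss_def log_loss_def elog_def)

text \<open>Quasi-integrability rules out \<open>\<infinity> - \<infinity>\<close>, so a finite
  difference has two finite terms.\<close>

lemma ext_integral_finite_imp:
  assumes "quasi_integrable M F" "\<bar>ext_integral M F\<bar> \<noteq> \<infinity>"
  shows "(\<integral>\<^sup>+ w. e2ennreal (F w) \<partial>M) < \<infinity>" "(\<integral>\<^sup>+ w. e2ennreal (- F w) \<partial>M) < \<infinity>"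
  using assms unfolding quasi_integrable_def ext_integral_def
  by (cases "\<integral>\<^sup>+ w. e2ennreal (F w) \<partial>M"; cases "\<integral>\<^sup>+ w. e2ennreal (- F w) \<partial>M"; auto)+

text \<open>Sample and test point form one i.i.d. tuple of length \<open>n + 1\<close>, to which
  \<open>integrable_exchangeable_sum\<close> is applied. Symmetry of the rule turns the sum of the
  transposed losses into the objective that \<open>fhat\<close> minimizes.\<close>

lemma augmented_erm_integral_le:
  fixes P :: "('x \<times> 'y) measure" and F \<phi> n fhat
  defines "S \<equiv> PiM {..<n} (\<lambda>_. P)"
  defines "A \<equiv> \<lambda>w. pen_loss \<phi> (fhat (fst w) (snd w)) (snd w)"
  assumes P: "prob_space P"
    and erm: "\<forall>zs\<in>space S. \<forall>z\<in>space P. is_pen_erm F \<phi> n zs z (fhat zs z)"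
    and sym: "symmetric_rule P n fhat"
    and A [measurable]: "A \<in> borel_measurable (S \<Otimes>\<^sub>M P)"
    and A_neg: "(\<integral>\<^sup>+ w. e2ennreal (- A w) \<partial>(S \<Otimes>\<^sub>M P)) < \<infinity>"
    and f: "f \<in> F" "quasi_integrable P (log_loss f)" "\<bar>risk P f\<bar> \<noteq> \<infinity>"
  shows "integrable (S \<Otimes>\<^sub>M P) (\<lambda>w. real_of_ereal (A w))"
    "AE w in S \<Otimes>\<^sub>M P. A w = ereal (real_of_ereal (A w))"
    "ereal (\<integral>w. real_of_ereal (A w) \<partial>(S \<Otimes>\<^sub>M P)) \<le> pen_risk P \<phi> f"
proof -
  interpret P: prob_space P by fact
  let ?I = "{..n}"
  define Q where "Q = PiM ?I (\<lambda>_. P)"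
  define U :: "(nat \<Rightarrow> 'x \<times> 'y) \<Rightarrow> _" where "U \<omega> = (restrict \<omega> {..<n}, \<omega> n)" for \<omega>
  \<comment> \<open>\<open>T i\<close> exchanges the \<open>i\<close>-th point with the test point;
    \<open>T n\<close> is the identity, so the loss itself is the summand of index
    \<open>n\<close>.\<close>
  define T :: "nat \<Rightarrow> (nat \<Rightarrow> 'x \<times> 'y) \<Rightarrow> _" where "T i \<omega> = (\<lambda>j\<in>?I. \<omega> (Transposition.transpose i n j))" for i \<omega>
  \<comment> \<open>The competitor has finite risk, so its loss is real almost everywhere, and
    \<open>g\<close> is a real version of its penalized loss.\<close>
  define g where "g z = real_of_ereal (log_loss f z) + \<phi> f" for z
  have I_insert: "?I = insert n {..<n}" by auto
  have U [measurable]: "U \<in> measurable Q (S \<Otimes>\<^sub>M P)"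
    unfolding U_def Q_def S_def
    by (intro measurable_Pair measurable_restrict_subset measurable_component_singleton) auto
  have distr_U: "distr Q (S \<Otimes>\<^sub>M P) U = S \<Otimes>\<^sub>M P"
    unfolding U_def[abs_def] Q_def S_def I_insert by (rule distr_PiM_insert_split) (use P in auto)
  have tr: "Transposition.transpose i n j \<in> ?I" if "i \<in> ?I" "j \<in> ?I" for i j
    using that by (auto simp: Transposition.transpose_def)
  have T_meas: "T i \<in> measurable Q Q" if "i \<in> ?I" for i
    unfolding T_def Q_def using tr[OF that]
    by (intro measurable_restrict measurable_component_singleton) auto
  have T_distr: "distr Q Q (T i) = Q" if "i \<in> ?I" for i
    unfolding T_def[abs_def] Q_def using tr[OF that]
    by (intro distr_PiM_reindex) (use P in \<open>auto intro: inj_on_subset[OF inj_transpose]\<close>)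
  \<comment> \<open>The exchange leaves the fitted density unchanged and only moves the point at
    which its loss is evaluated from position \<open>n\<close> to \<open>i\<close>.\<close>
  have B_T: "A (U (T i \<omega>)) = pen_loss \<phi> (fhat (restrict \<omega> {..<n}) (\<omega> n)) (\<omega> i)"
    if i: "i \<in> ?I" and \<omega>: "\<omega> \<in> space Q" for i \<omega>
  proof -
    have "Transposition.transpose i n permutes ?I"
      using i by (intro permutes_swap_id) auto
    with sym \<omega> have "fhat (restrict (\<omega> \<circ> Transposition.transpose i n) {..<n}) (\<omega> (Transposition.transpose i n n)) =
        fhat (restrict \<omega> {..<n}) (\<omega> n)"
      unfolding symmetric_rule_def Q_def by blast
    moreover have "restrict (T i \<omega>) {..<n} = restrict (\<omega> \<circ> Transposition.transpose i n) {..<n}"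
      by (auto simp: T_def fun_eq_iff)
    ultimately show ?thesis
      by (simp add: A_def U_def T_def)
  qed
  have log_f: "log_loss f \<in> borel_measurable P" "(\<integral>\<^sup>+ z. e2ennreal (log_loss f z) \<partial>P) < \<infinity>"
    "(\<integral>\<^sup>+ z. e2ennreal (- log_loss f z) \<partial>P) < \<infinity>"
    using f(2) ext_integral_finite_imp[OF f(2)] f(3)
    by (simp_all add: quasi_integrable_def risk_def)
  note log_int = integrable_real_of_ereal[OF log_f]
  have g: "integrable P g" "AE z in P. pen_loss \<phi> f z = ereal (g z)"
    using log_int(1) unfolding g_def pen_loss_def
    by (simp, use log_int(2) in eventually_elim) (metis plus_ereal.simps(1))
  have pen_f: "pen_risk P \<phi> f = ereal (integral\<^sup>L P g)"
    using ext_integral_eq_integral[OF log_int] log_int(1)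
    by (simp add: pen_risk_def risk_def g_def[abs_def] P.prob_space)
  have comp: "(\<lambda>\<omega>. \<omega> i) \<in> measurable Q P" "distr Q P (\<lambda>\<omega>. \<omega> i) = P" if "i \<in> ?I" for i
    unfolding Q_def using that P by (auto intro!: distr_PiM_component[where M="\<lambda>_. P"])
  have "AE \<omega> in Q. \<forall>i\<in>?I. pen_loss \<phi> f (\<omega> i) = ereal (g (\<omega> i))"
  proof (intro AE_finite_allI)
    fix i assume i: "i \<in> ?I"
    show "AE \<omega> in Q. pen_loss \<phi> f (\<omega> i) = ereal (g (\<omega> i))"
      by (rule AE_distrD[OF comp(1)[OF i]]) (use g(2) in \<open>subst comp(2)[OF i]\<close>)
  qed simp
  then have sum_le: "AE \<omega> in Q. (\<Sum>i\<in>?I. (A \<circ> U) (T i \<omega>)) \<le> ereal (\<Sum>i\<in>?I. g (\<omega> i))"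
    using AE_space
  proof eventually_elim
    case (elim \<omega>)
    let ?zs = "restrict \<omega> {..<n}" and ?z = "\<omega> n"
    have "U \<omega> \<in> space (S \<Otimes>\<^sub>M P)" using measurable_space[OF U elim(2)] .
    then have "is_pen_erm F \<phi> n ?zs ?z (fhat ?zs ?z)"
      using erm by (auto simp: U_def space_pair_measure)
    with f(1) have "(\<Sum>i<n. pen_loss \<phi> (fhat ?zs ?z) (\<omega> i)) + pen_loss \<phi> (fhat ?zs ?z) ?z
        \<le> (\<Sum>i<n. pen_loss \<phi> f (\<omega> i)) + pen_loss \<phi> f ?z"
      by (auto simp: is_pen_erm_def is_arg_min_def not_less)
    then show ?case
      using elim by (simp add: B_T I_insert add.commute)
  qed
  have B_neg: "(\<integral>\<^sup>+ \<omega>. e2ennreal (- (A \<circ> U) \<omega>) \<partial>Q) < \<infinity>"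
    using A_neg by (subst (asm) distr_U[symmetric]) (simp add: nn_integral_distr)
  have g_comp: "integrable Q (\<lambda>\<omega>. g (\<omega> i))" "(\<integral>\<omega>. g (\<omega> i) \<partial>Q) = integral\<^sup>L P g"
    if "i \<in> ?I" for i
    using g(1) comp[OF that]
    by (metis integrable_distr, metis borel_measurable_integrable integral_distr)
  have T_n: "T n \<omega> = \<omega>" if "\<omega> \<in> space Q" for \<omega>
    using that by (auto simp: T_def Q_def space_PiM PiE_def extensional_def fun_eq_iff)
  have B_meas: "A \<circ> U \<in> borel_measurable Q" by measurable
  have "(A \<circ> U) \<omega> \<noteq> - \<infinity>" for \<omega>
    by (simp add: A_def pen_loss_not_MInf)
  note exch = integrable_exchangeable_sum[where T=T and G="\<lambda>i \<omega>. g (\<omega> i)",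
      OF finite_atMost _ T_meas T_distr T_n B_meas B_neg this g_comp sum_le]
  have Ar: "(\<lambda>w. real_of_ereal (A w)) \<in> borel_measurable (S \<Otimes>\<^sub>M P)" by measurable
  show "integrable (S \<Otimes>\<^sub>M P) (\<lambda>w. real_of_ereal (A w))"
    using exch(1) integrable_distr_eq[OF U Ar] by (simp add: distr_U)
  have "(AE w in distr Q (S \<Otimes>\<^sub>M P) U. A w = ereal (real_of_ereal (A w)))"
    using exch(2) by (subst AE_distr_iff[OF U]) auto
  then show "AE w in S \<Otimes>\<^sub>M P. A w = ereal (real_of_ereal (A w))"
    unfolding distr_U .
  show "ereal (\<integral>w. real_of_ereal (A w) \<partial>(S \<Otimes>\<^sub>M P)) \<le> pen_risk P \<phi> f"
    using exch(3) integral_distr[OF U Ar] by (simp add: distr_U pen_f)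
qed

section \<open>Decomposition of the loss of the predictor\<close>

lemma integral_sum_decomposition:
  fixes L A N :: "'a \<Rightarrow> ereal"
  assumes [measurable]: "L \<in> borel_measurable M" "A \<in> borel_measurable M" "N \<in> borel_measurable M"
    and eq: "AE w in M. L w = A w + N w"
    and N_fin: "AE w in M. \<bar>N w\<bar> \<noteq> \<infinity>"
    and N_pos: "(\<integral>\<^sup>+ w. e2ennreal (N w) \<partial>M) < \<infinity>"
    and L_neg: "(\<integral>\<^sup>+ w. e2ennreal (- L w) \<partial>M) < \<infinity>"
    and A: "(\<integral>\<^sup>+ w. e2ennreal (- A w) \<partial>M) < \<infinity> \<Longrightarrow>
       integrable M (\<lambda>w. real_of_ereal (A w)) \<and> (AE w in M. A w = ereal (real_of_ereal (A w)))"
  shows "(\<integral>\<^sup>+ w. e2ennreal (L w) \<partial>M) < \<infinity>"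
    and "integrable M (\<lambda>w. real_of_ereal (A w))"
    and "(\<integral>\<^sup>+ w. e2ennreal (- A w) \<partial>M) < \<infinity>"
    and "ext_integral M N = ereal ((\<integral>w. real_of_ereal (L w) \<partial>M) - (\<integral>w. real_of_ereal (A w) \<partial>M))"
proof -
  \<comment> \<open>As \<open>A = L - N\<close>, the negative part of \<open>A\<close> is at most
    that of \<open>L\<close> plus the positive part of \<open>N\<close>. This finiteness unlocks the
    conditional assumption \<open>A\<close>, which supplies integrability.\<close>
  have "(\<integral>\<^sup>+ w. e2ennreal (- A w) \<partial>M) \<le> (\<integral>\<^sup>+ w. e2ennreal (- L w) + e2ennreal (N w) \<partial>M)"
  proof (rule nn_integral_mono_AE, use eq N_fin in eventually_elim)
    case (elim w)
    then show ?case
      by (cases "A w"; cases "N w")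
        (auto simp: e2ennreal_neg ennreal_plus_if ennreal_neg intro!: ennreal_leI)
  qed
  also have "\<dots> < \<infinity>" using N_pos L_neg by (subst nn_integral_add) auto
  finally show A_neg: "(\<integral>\<^sup>+ w. e2ennreal (- A w) \<partial>M) < \<infinity>" .
  note A = A[OF this]
  then show A_int: "integrable M (\<lambda>w. real_of_ereal (A w))" ..
  have "(\<integral>\<^sup>+ w. e2ennreal (A w) \<partial>M) = (\<integral>\<^sup>+ w. ennreal (real_of_ereal (A w)) \<partial>M)"
    by (rule nn_integral_cong_AE, use A[THEN conjunct2] in eventually_elim) (metis e2ennreal_ereal)
  also have "\<dots> < \<infinity>" using A_int by (simp add: real_integrable_def less_top)
  finally have A_pos: "(\<integral>\<^sup>+ w. e2ennreal (A w) \<partial>M) < \<infinity>" .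
  \<comment> \<open>Integrability of \<open>A\<close> in turn bounds the positive part of
    \<open>L\<close>, so \<open>N\<close> is almost everywhere a difference of two integrable
    functions.\<close>
  have "(\<integral>\<^sup>+ w. e2ennreal (L w) \<partial>M) \<le> (\<integral>\<^sup>+ w. e2ennreal (A w) + e2ennreal (N w) \<partial>M)"
  proof (rule nn_integral_mono_AE, use eq N_fin in eventually_elim)
    case (elim w)
    then show ?case
      by (cases "A w"; cases "N w")
        (auto simp: e2ennreal_neg ennreal_plus_if ennreal_neg intro!: ennreal_leI)
  qed
  also have "\<dots> < \<infinity>" using N_pos A_pos by (subst nn_integral_add) auto
  finally show L_pos: "(\<integral>\<^sup>+ w. e2ennreal (L w) \<partial>M) < \<infinity>" .
  have L_meas: "L \<in> borel_measurable M" by measurable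
  note L = integrable_real_of_ereal[OF L_meas L_pos L_neg]
  have "AE w in M. N w = ereal (real_of_ereal (L w) - real_of_ereal (A w))"
    using eq N_fin A[THEN conjunct2]
  proof eventually_elim
    case (elim w)
    then show ?case by (cases "A w"; cases "N w") auto
  qed
  then show "ext_integral M N = ereal ((\<integral>w. real_of_ereal (L w) \<partial>M) - (\<integral>w. real_of_ereal (A w) \<partial>M))"
    using L(1) A_int by (subst ext_integral_eq_integral) auto
qed

text \<open>Taking logarithms of the quotient gives the identity. Where \<open>fhat\<close> vanishes
  it survives with \<infinity> on both sides, the logarithm of the normalizer being real.\<close>

lemma log_loss_smp:
  assumes "0 \<le> fhat zs z (fst z) (snd z)"
    and "0 < smp_norm \<mu> \<phi> fhat zs (fst z)" "smp_norm \<mu> \<phi> fhat zs (fst z) < \<infinity>"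
  shows "log_loss (smp \<mu> \<phi> fhat zs) z = pen_loss \<phi> (fhat zs z) z + elog (smp_norm \<mu> \<phi> fhat zs (fst z))"
proof -
  define c where "c = enn2real (smp_norm \<mu> \<phi> fhat zs (fst z))"
  have c: "c > 0" "smp_norm \<mu> \<phi> fhat zs (fst z) = ennreal c"
    using assms(2,3) by (auto simp: c_def enn2real_positive_iff)
  show ?thesis
    using assms(1) c by (auto simp: log_loss_def pen_loss_def smp_def smp_weight_def elog_def
      ln_mult ln_div ennreal_eq_0_iff not_le)
qed

section \<open>Optimality and excess risk of the sample minmax predictor\<close>

theorem theorem2:
  fixes MX :: "'x measure" and \<mu> :: "'y measure"
    and P :: "('x \<times> 'y) measure"
    and F :: "('x, 'y) cdens set" and \<phi> :: "('x, 'y) cdens \<Rightarrow> real"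
    and n :: nat
    and fhat :: "(nat \<Rightarrow> 'x \<times> 'y) \<Rightarrow> 'x \<times> 'y \<Rightarrow> ('x, 'y) cdens"
    and \<Omega> :: "'w measure"
    and Z :: "nat \<Rightarrow> 'w \<Rightarrow> 'x \<times> 'y" and X :: "'w \<Rightarrow> 'x" and Y :: "'w \<Rightarrow> 'y"
  defines "MZ \<equiv> MX \<Otimes>\<^sub>M \<mu>"
  defines "S \<equiv> PiM {..<n} (\<lambda>_. MX \<Otimes>\<^sub>M \<mu>)"
  defines "Zn \<equiv> \<lambda>\<omega>. restrict (\<lambda>i. Z i \<omega>) {..<n}"
  assumes P_prob: "prob_space P" and P_sets: "sets P = sets MZ"
    and F_dens: "\<forall>f\<in>F. cond_dens MX \<mu> f"
    and F_risk: "\<forall>f\<in>F. quasi_integrable P (log_loss f) \<and> risk P f \<noteq> - \<infinity>"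
    and inf_finite: "\<bar>INF f\<in>F. pen_risk P \<phi> f\<bar> \<noteq> \<infinity>"
    and fhat_erm: "\<forall>zs\<in>space S. \<forall>z\<in>space MZ. is_pen_erm F \<phi> n zs z (fhat zs z)"
    and fhat_sym: "symmetric_rule MZ n fhat"
    and fhat_meas: "(\<lambda>(zs, z). fhat zs z (fst z) (snd z)) \<in> borel_measurable (S \<Otimes>\<^sub>M MZ)"
    and pen_meas: "(\<lambda>(zs, z). \<phi> (fhat zs z)) \<in> borel_measurable (S \<Otimes>\<^sub>M MZ)"
    and norm_meas: "(\<lambda>(zs, x). smp_norm \<mu> \<phi> fhat zs x) \<in> borel_measurable (S \<Otimes>\<^sub>M MX)"
    and Omega_prob: "prob_space \<Omega>"
    and indep: "prob_space.indep_vars \<Omega> (\<lambda>_. MZ) (Z(n := (\<lambda>\<omega>. (X \<omega>, Y \<omega>)))) {..n}"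
    and Z_distr: "\<forall>i<n. distr \<Omega> MZ (Z i) = P"
    and XY_distr: "distr \<Omega> MZ (\<lambda>\<omega>. (X \<omega>, Y \<omega>)) = P"
    and norm_ae: "AE \<omega> in \<Omega>. 0 < smp_norm \<mu> \<phi> fhat (Zn \<omega>) (X \<omega>) \<and>
                              smp_norm \<mu> \<phi> fhat (Zn \<omega>) (X \<omega>) < \<infinity>"
    and loss_wd: "quasi_integrable \<Omega> (\<lambda>\<omega>. log_loss (smp \<mu> \<phi> fhat (Zn \<omega>)) (X \<omega>, Y \<omega>))"
    and bound_wd: "quasi_integrable \<Omega> (\<lambda>\<omega>. elog (smp_norm \<mu> \<phi> fhat (Zn \<omega>) (X \<omega>)))"
  shows "(\<forall>zs\<in>space S. \<forall>x\<in>space MX.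
            0 < smp_norm \<mu> \<phi> fhat zs x \<and> smp_norm \<mu> \<phi> fhat zs x < \<infinity> \<longrightarrow>
              is_smp \<mu> \<phi> fhat zs x (smp \<mu> \<phi> fhat zs x) \<and>
              (\<forall>p. is_smp \<mu> \<phi> fhat zs x p \<longrightarrow> (AE y in \<mu>. p y = smp \<mu> \<phi> fhat zs x y)))
       \<and> ext_integral \<Omega> (\<lambda>\<omega>. pen_excess_risk P \<phi> F (smp \<mu> \<phi> fhat (Zn \<omega>)))
            \<le> ext_integral \<Omega> (\<lambda>\<omega>. elog (smp_norm \<mu> \<phi> fhat (Zn \<omega>) (X \<omega>)))"
proof -
  interpret P: prob_space P by fact
  interpret \<Omega>: prob_space \<Omega> by fact
  \<comment> \<open>\<open>S\<close> fixes the sigma-algebra of samples, \<open>S'\<close> carries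
    their law on it, and \<open>D\<close> is the joint law of sample and test point.\<close>
  define S' where "S' = PiM {..<n} (\<lambda>_. P)"
  define D where "D = S' \<Otimes>\<^sub>M P"
  interpret S': prob_space S' unfolding S'_def by (intro prob_space_PiM P_prob)
  have space_P: "space P = space MZ" using P_sets by (rule sets_eq_imp_space_eq)
  have sets_S': "sets S' = sets S"
    unfolding S'_def S_def using P_sets by (intro sets_PiM_cong) (auto simp: MZ_def)
  then have space_S': "space S' = space S" by (rule sets_eq_imp_space_eq)
  have sets_D: "sets D = sets (S \<Otimes>\<^sub>M MZ)"
    unfolding D_def using sets_S' P_sets by (intro sets_pair_measure_cong)
  have fhat_F: "fhat zs z \<in> F" if "zs \<in> space S" "z \<in> space MZ" for zs z
    using fhat_erm that by (auto simp: is_pen_erm_def is_arg_min_def)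
  have fhat_nonneg: "0 \<le> fhat zs z (fst z) (snd z)" if "zs \<in> space S" "z \<in> space MZ" for zs z
    using F_dens fhat_F[OF that] that(2)
    by (auto simp: cond_dens_def prob_dens_def MZ_def space_pair_measure)

  have smp_opt: "is_smp \<mu> \<phi> fhat zs x (smp \<mu> \<phi> fhat zs x) \<and>
      (\<forall>p. is_smp \<mu> \<phi> fhat zs x p \<longrightarrow> (AE y in \<mu>. p y = smp \<mu> \<phi> fhat zs x y))"
    if zs: "zs \<in> space S" and x: "x \<in> space MX"
      and "0 < smp_norm \<mu> \<phi> fhat zs x \<and> smp_norm \<mu> \<phi> fhat zs x < \<infinity>" for zs x
  proof -
    have slice: "(\<lambda>y. (zs, (x, y))) \<in> measurable \<mu> (S \<Otimes>\<^sub>M MZ)"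
      using zs x unfolding MZ_def by measurable
    have "smp_weight \<phi> fhat zs x \<in> borel_measurable \<mu>"
      using measurable_compose[OF slice fhat_meas] measurable_compose[OF slice pen_meas]
      by (simp add: smp_weight_def[abs_def])
    moreover have "0 \<le> fhat zs (x, y) x y" if "y \<in> space \<mu>" for y
      using fhat_nonneg[OF zs, of "(x, y)"] x that by (simp add: MZ_def space_pair_measure)
    ultimately show ?thesis
      using that(3) smp_is_smp_unique[of \<mu> fhat zs x \<phi>] by blast
  qed

  \<comment> \<open>Measurability of the loss and its two summands\<close>
  define h where "h w = fhat (fst w) (snd w) (fst (snd w)) (snd (snd w))" for w
  define \<psi> where "\<psi> w = \<phi> (fhat (fst w) (snd w))" for w
  define c where "c w = smp_norm \<mu> \<phi> fhat (fst w) (fst (snd w))" for w :: "(nat \<Rightarrow> 'x \<times> 'y) \<times> 'x \<times> 'y"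
  define A where "A = (\<lambda>w. pen_loss \<phi> (fhat (fst w) (snd w)) (snd w))"
  define L where "L w = log_loss (smp \<mu> \<phi> fhat (fst w)) (snd w)" for w
  define N where "N w = elog (c w)" for w
  have D_cong: "measurable D K = measurable (S \<Otimes>\<^sub>M MZ) K" for K :: "'k measure"
    using sets_D by (intro measurable_cong_sets) auto
  have [measurable]: "h \<in> borel_measurable D" "\<psi> \<in> borel_measurable D"
    using fhat_meas pen_meas by (auto simp: D_cong h_def[abs_def] \<psi>_def[abs_def] case_prod_beta')
  have "(\<lambda>w. (fst w, fst (snd w))) \<in> measurable D (S \<Otimes>\<^sub>M MX)"
    unfolding D_cong MZ_def by measurable
  from measurable_compose[OF this norm_meas] have [measurable]: "c \<in> borel_measurable D"
    by (simp add: c_def[abs_def])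
  have A_meas [measurable]: "A \<in> borel_measurable D"
  proof -
    have "A = (\<lambda>w. - elog (ennreal (h w)) + ereal (\<psi> w))"
      by (simp add: A_def h_def \<psi>_def pen_loss_def log_loss_def)
    then show ?thesis by simp
  qed
  have L_meas [measurable]: "L \<in> borel_measurable D"
  proof -
    have "L = (\<lambda>w. - elog (ennreal (h w * exp (- \<psi> w) / enn2real (c w))))"
      by (simp add: L_def[abs_def] h_def \<psi>_def c_def log_loss_def smp_def smp_weight_def)
    then show ?thesis by simp
  qed
  have N_meas [measurable]: "N \<in> borel_measurable D"
    unfolding N_def by measurable

  \<comment> \<open>Joint law of the sample and the test point\<close>
  define V where "V \<omega> = (Zn \<omega>, (X \<omega>, Y \<omega>))" for \<omega>
  \<comment> \<open>The test point becomes the observation of index \<open>n\<close>, so that all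
    \<open>n + 1\<close> observations form one independent family with common law
    \<open>P\<close>.\<close>
  define Z' where "Z' = Z(n := (\<lambda>\<omega>. (X \<omega>, Y \<omega>)))"
  have rv: "Z' i \<in> measurable \<Omega> MZ" if "i \<in> {..n}" for i
    using indep that by (auto simp: \<Omega>.indep_vars_def Z'_def)
  have Z'_distr: "distr \<Omega> MZ (Z' i) = P" if "i \<in> {..n}" for i
    using that Z_distr XY_distr by (auto simp: Z'_def)
  have W: "(\<lambda>\<omega>. \<lambda>i\<in>{..n}. Z' i \<omega>) \<in> measurable \<Omega> (PiM {..n} (\<lambda>_. MZ))"
    using rv by (intro measurable_restrict)
  have W_distr: "distr \<Omega> (PiM {..n} (\<lambda>_. MZ)) (\<lambda>\<omega>. \<lambda>i\<in>{..n}. Z' i \<omega>) = PiM {..n} (\<lambda>_. P)"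
  proof -
    have "PiM {..n} (\<lambda>i. distr \<Omega> MZ (Z' i)) = PiM {..n} (\<lambda>_. P)"
      by (intro PiM_cong refl Z'_distr)
    then show ?thesis
      using \<Omega>.indep_vars_iff_distr_eq_PiM'[of "{..n}" Z' "\<lambda>_. MZ"] rv indep
      by (simp add: Z'_def[symmetric])
  qed
  have U: "(\<lambda>\<omega>. (restrict \<omega> {..<n}, \<omega> n)) \<in> measurable (PiM {..n} (\<lambda>_. MZ)) D"
    unfolding measurable_cong_sets[OF refl sets_D] S_def MZ_def
    by (intro measurable_Pair measurable_restrict_subset measurable_component_singleton) auto
  have V_eq: "V \<omega> = (\<lambda>\<omega>. (restrict \<omega> {..<n}, \<omega> n)) (\<lambda>i\<in>{..n}. Z' i \<omega>)" for \<omega>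
    by (auto simp: V_def Zn_def Z'_def fun_eq_iff)
  have V [measurable]: "V \<in> measurable \<Omega> D"
    unfolding V_eq[abs_def] by (rule measurable_compose[OF W U])
  have V_distr: "distr \<Omega> D V = D"
  proof -
    have "distr \<Omega> D V = distr (PiM (insert n {..<n}) (\<lambda>_. P)) D (\<lambda>\<omega>. (restrict \<omega> {..<n}, \<omega> n))"
      unfolding V_eq[abs_def] using distr_distr[OF U W] W_distr
      by (simp add: comp_def lessThan_Suc[symmetric] lessThan_Suc_atMost)
    also have "\<dots> = D"
      unfolding D_def S'_def by (rule distr_PiM_insert_split) (use P_prob in auto)
    finally show ?thesis .
  qed
  \<comment> \<open>Both sides of the risk bound depend on \<omega> only through \<open>V\<close>,
    so they become expectations under \<open>D\<close>.\<close>
  have ext_D: "ext_integral \<Omega> (\<lambda>\<omega>. G (V \<omega>)) = ext_integral D G" if "G \<in> borel_measurable D" for G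
    using ext_integral_distr[OF V that] by (simp add: V_distr)

  have N_fin: "AE w in D. 0 < c w \<and> c w < \<infinity>"
  proof -
    have "{w \<in> space D. 0 < c w \<and> c w < \<infinity>} \<in> sets D" by measurable
    from AE_distr_iff[OF V this] have "AE w in distr \<Omega> D V. 0 < c w \<and> c w < \<infinity>"
      using norm_ae by (simp add: c_def V_def)
    then show ?thesis unfolding V_distr .
  qed
  then have decomp: "AE w in D. L w = A w + N w"
    using AE_space
    by eventually_elim (auto simp: L_def A_def N_def c_def D_def space_pair_measure space_S' space_P
      intro!: log_loss_smp fhat_nonneg)
  have N_abs: "AE w in D. \<bar>N w\<bar> \<noteq> \<infinity>"
    using N_fin by eventually_elim (auto simp: N_def elog_def)
  have L_quasi: "(\<integral>\<^sup>+ w. e2ennreal (L w) \<partial>D) < \<infinity> \<or> (\<integral>\<^sup>+ w. e2ennreal (- L w) \<partial>D) < \<infinity>"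
  proof -
    have "(\<integral>\<^sup>+ w. H (L w) \<partial>D) = (\<integral>\<^sup>+ \<omega>. H (L (V \<omega>)) \<partial>\<Omega>)"
      if "H \<in> borel_measurable borel" for H :: "ereal \<Rightarrow> ennreal"
      using nn_integral_distr[OF V, of "\<lambda>w. H (L w)"] that by (simp add: V_distr)
    from this[of e2ennreal] this[of "\<lambda>x. e2ennreal (- x)"] show ?thesis
      using loss_wd by (simp add: quasi_integrable_def L_def V_def)
  qed

  obtain e where e: "(INF f\<in>F. pen_risk P \<phi> f) = ereal e"
    using inf_finite by (cases "INF f\<in>F. pen_risk P \<phi> f") auto
  define R where "R zs = risk P (smp \<mu> \<phi> fhat zs) - ereal e" for zs
  have R_eq: "R = (\<lambda>zs. ext_integral P (\<lambda>z. L (zs, z)) - ereal e)"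
    by (simp add: R_def[abs_def] risk_def L_def)
  have R_meas: "R \<in> borel_measurable S'"
    unfolding R_eq using L_meas unfolding D_def
    by (intro borel_measurable_ereal_diff borel_measurable_ext_integral_fibre)
      (auto intro: P.sigma_finite_measure_axioms)
  \<comment> \<open>The excess risk is a function of the sample alone, whose law is the first
    marginal of \<open>D\<close>.\<close>
  have lhs: "ext_integral \<Omega> (\<lambda>\<omega>. pen_excess_risk P \<phi> F (smp \<mu> \<phi> fhat (Zn \<omega>))) = ext_integral S' R"
  proof -
    have fst_meas: "fst \<in> measurable D S'" unfolding D_def by measurable
    have "distr D S' fst = S'"
      unfolding D_def by (rule P.distr_pair_fst)
    then have "ext_integral S' R = ext_integral D (\<lambda>w. R (fst w))"
      using ext_integral_distr[OF fst_meas R_meas] by simp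
    also have "\<dots> = ext_integral \<Omega> (\<lambda>\<omega>. R (fst (V \<omega>)))"
      using measurable_compose[OF fst_meas R_meas] by (rule ext_D[symmetric])
    finally show ?thesis
      by (simp add: V_def R_def pen_excess_risk_def e)
  qed
  have rhs: "ext_integral \<Omega> (\<lambda>\<omega>. elog (smp_norm \<mu> \<phi> fhat (Zn \<omega>) (X \<omega>))) = ext_integral D N"
    using ext_D[OF N_meas] by (simp add: N_def c_def V_def)

  have erm_f: "integrable D (\<lambda>w. real_of_ereal (A w)) \<and> (AE w in D. A w = ereal (real_of_ereal (A w))) \<and>
      ereal (\<integral>w. real_of_ereal (A w) \<partial>D) \<le> pen_risk P \<phi> f"
    if neg: "(\<integral>\<^sup>+ w. e2ennreal (- A w) \<partial>D) < \<infinity>" and f: "f \<in> F" "pen_risk P \<phi> f \<noteq> \<infinity>" for f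
  proof -
    have sym: "symmetric_rule P n fhat"
      using fhat_sym sets_symmetric_rule_cong[OF P_sets] by simp
    have erm: "\<forall>zs\<in>space (PiM {..<n} (\<lambda>_. P)). \<forall>z\<in>space P. is_pen_erm F \<phi> n zs z (fhat zs z)"
      using fhat_erm space_S' space_P by (simp add: S'_def)
    have "quasi_integrable P (log_loss f)" "\<bar>risk P f\<bar> \<noteq> \<infinity>"
      using F_risk f by (auto simp: pen_risk_def)
    note augmented_erm_integral_le[OF P_prob erm sym A_meas[unfolded A_def D_def S'_def]
        neg[unfolded A_def D_def S'_def] f(1) this]
    then show ?thesis
      unfolding A_def D_def S'_def by (intro conjI)
  qed
  \<comment> \<open>A finite infimum forces a competitor of finite penalized risk, since the infimum
    would otherwise be \<infinity>. It makes \<open>A\<close> integrable before any comparison with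
    the infimum.\<close>
  obtain f0 where f0: "f0 \<in> F" "pen_risk P \<phi> f0 \<noteq> \<infinity>"
  proof (rule ccontr)
    assume "\<not> thesis"
    then have "\<infinity> \<le> (INF f\<in>F. pen_risk P \<phi> f)"
      using that by (intro INF_greatest) auto
    with e show False by simp
  qed

  \<comment> \<open>The excess risk bound under the canonical law\<close>
  have "ext_integral S' R \<le> ext_integral D N"
  proof (cases "(\<integral>\<^sup>+ w. e2ennreal (N w) \<partial>D) < \<infinity>")
    case False
    then show ?thesis by (simp add: ext_integral_def not_less top_unique)
  next
    case N_pos: True
    show ?thesis
    proof (cases "(\<integral>\<^sup>+ w. e2ennreal (- L w) \<partial>D) < \<infinity>")
      case False
      then have "(\<integral>\<^sup>+ w. e2ennreal (- L w) \<partial>D) = \<infinity>" by (simp add: not_less top_unique)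
      \<comment> \<open>\<open>L_quasi\<close> leaves a finite positive part here, so integrating
        over the fibres yields -\<infinity> on the left.\<close>
      with False L_quasi have "ext_integral S' R = - \<infinity>"
        unfolding R_eq D_def
        by (intro ext_integral_fibre_minus_infty S'.prob_space_axioms P_prob)
          (use L_meas in \<open>auto simp: D_def\<close>)
      then show ?thesis by simp
    next
      case True
      note dec = integral_sum_decomposition[OF L_meas A_meas N_meas decomp N_abs N_pos True]
      have A: "integrable D (\<lambda>w. real_of_ereal (A w)) \<and> (AE w in D. A w = ereal (real_of_ereal (A w)))"
        if "(\<integral>\<^sup>+ w. e2ennreal (- A w) \<partial>D) < \<infinity>"
        using erm_f[OF that f0] by blast
      \<comment> \<open>The expectation of \<open>A\<close> is below the penalized risk of every
        competitor, trivially if that risk is \<infinity>, hence below the infimum.\<close>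
      have "ereal (\<integral>w. real_of_ereal (A w) \<partial>D) \<le> ereal e"
        unfolding e[symmetric]
      proof (rule INF_greatest)
        fix f assume "f \<in> F"
        then show "ereal (\<integral>w. real_of_ereal (A w) \<partial>D) \<le> pen_risk P \<phi> f"
          using erm_f[OF dec(3)[OF A], of f] by (cases "pen_risk P \<phi> f = \<infinity>") auto
      qed
      moreover have "ext_integral S' R = ereal ((\<integral>w. real_of_ereal (L w) \<partial>D) - e)"
        using dec(1)[OF A] True L_meas unfolding R_eq D_def
        by (intro ext_integral_fibre_real S'.prob_space_axioms P_prob) auto
      \<comment> \<open>The two sides are \<open>E L - e\<close> and \<open>E L - E A\<close>, so
        the claim reduces to \<open>E A \<le> e\<close>.\<close>
      ultimately show ?thesis
        using dec(4)[OF A] by simp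
    qed
  qed
  with smp_opt lhs rhs show ?thesis by simp
qed

end
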